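(* Let $n,d$ be positive integers and let $S\subseteq\mathbb{Z}^n\setminus\{0\}$ be a finite generating set of the group $\mathbb{Z}^n$. Then there are a positive integer $\Delta\ge d$ and a clopen set $M\subseteq \mathsf{Free}(2^{\mathbb{Z}^n})$ such that: (1) if $x,y\in M$ are distinct and lie in the same orbit of the Bernoulli shift action, then $\rho(x,y)\ge d$; (2) for every $g\in S$ and every $x\in \mathsf{Free}(2^{\mathbb{Z}^n})$, there are non-negative integers $a,b\le \Delta$ such that $(ag)\cdot x\in M$ and $(-bg)\cdot x\in M$.
   Context: The group $\mathbb{Z}^n$ acts on $2^{\mathbb{Z}^n}=\{0,1\}^{\mathbb{Z}^n}$ (with the product topology, $\{0,1\}$ being discrete) by the Bernoulli shift $(g\cdot x)(h)=x(g+h)$ for $g,h\in\mathbb{Z}^n$. The free part $\mathsf{Free}(2^{\mathbb{Z}^n})$ is the set of all $x\in 2^{\mathbb{Z}^n}$ whose stabilizer is trivial, i.e. $g\cdot x=x$ implies $g=0$; it is equipped with the subspace topology, and "clopen subset of $\mathsf{Free}(2^{\mathbb{Z}^n})$" means clopen in this subspace topology. If $x,y\in\mathsf{Free}(2^{\mathbb{Z}^n})$ lie in the same orbit, then $\rho(x,y):=\|g\|_\infty=\max_{1\le i\le n}|g_i|$, where $g\in\mathbb{Z}^n$ is the unique element with $y=g\cdot x$. *)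

theory Defs
  imports "HOL-Analysis.Analysis" "HOL-Computational_Algebra.Group_Closure"
begin

text \<open>
  \<open>\<int>\<^sup>n\<close> is \<^typ>\<open>int ^ 'n\<close> for a finite index type \<open>'n\<close>, and \<open>2\<^sup>\<int>\<^sup>n\<close> is \<^typ>\<open>int ^ 'n \<Rightarrow> bool\<close>.
  The library topology on this function type is the product topology, and the one on
  \<^typ>\<open>bool\<close> is discrete; the topology that \<^typ>\<open>int ^ 'n\<close> itself carries plays no role.
\<close>

definition shift :: "int ^ 'n \<Rightarrow> (int ^ 'n \<Rightarrow> bool) \<Rightarrow> (int ^ 'n \<Rightarrow> bool)"
  where "shift g x = (\<lambda>h. x (g + h))"

definition Free :: "(int ^ 'n \<Rightarrow> bool) set"
  where "Free = {x. \<forall>g. shift g x = x \<longrightarrow> g = 0}"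

definition orbit :: "(int ^ 'n \<Rightarrow> bool) \<Rightarrow> (int ^ 'n \<Rightarrow> bool) set"
  where "orbit x = range (\<lambda>g. shift g x)"

definition sup_norm :: "int ^ 'n \<Rightarrow> int"
  where "sup_norm g = Max (range (\<lambda>i. \<bar>g $ i\<bar>))"

text \<open>Meaningful only for \<open>x \<in> Free\<close> and \<open>y \<in> orbit x\<close>, where the described \<open>g\<close> exists and is
  unique; see \<open>rho_shift\<close> below.\<close>

definition rho :: "(int ^ 'n \<Rightarrow> bool) \<Rightarrow> (int ^ 'n \<Rightarrow> bool) \<Rightarrow> int"
  where "rho x y = sup_norm (THE g. y = shift g x)"

definition clopen_in_Free :: "(int ^ 'n \<Rightarrow> bool) set \<Rightarrow> bool"
  where "clopen_in_Free M \<longleftrightarrow> openin (top_of_set Free) M \<and> closedin (top_of_set Free) M"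

lemma shift_0 [simp]: "shift 0 x = x"
  by (simp add: shift_def)

lemma shift_shift: "shift g (shift h x) = shift (g + h) x"
  by (simp add: shift_def add.assoc add.left_commute)

lemma shift_eq_iff:
  assumes "x \<in> Free"
  shows "shift g x = shift h x \<longleftrightarrow> g = h"
proof
  assume "shift g x = shift h x"
  then have "shift (- h) (shift g x) = shift (- h) (shift h x)"
    by simp
  then have "shift (g - h) x = x"
    by (simp add: shift_shift)
  then show "g = h"
    using assms by (auto simp: Free_def)
qed simp

lemma rho_shift:
  assumes "x \<in> Free"
  shows "rho x (shift g x) = sup_norm g"
  by (simp add: rho_def shift_eq_iff [OF assms])

end

theory Submission
  imports Defs
begin

text \<open>
  Directions are handled one at a time. Let \<open>F\<close> be the finite set of displacements forbidden within
  the marker set, and suppose that \<open>A\<close> already serves the earlier directions and has, for the new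
  direction \<open>g\<close> and \<open>L = 2|F \<union> {0}|\<close>, no two points at a displacement in
  \<open>F' = F \<union> {j g : 0 < |j| \<le> L}\<close>. Add to \<open>A\<close> a maximal clopen \<open>F'\<close>-independent set \<open>B\<close> of points
  that do not conflict with \<open>A\<close>. If \<open>B\<close> missed \<open>x, g x, \<dots>, 3L g x\<close>, then each of the \<open>L + 1\<close> middle
  points would have an \<open>h\<close>-translate in \<open>A\<close> or in \<open>B\<close>, with \<open>h \<in> F \<union> {0}\<close>. As \<open>A\<close> and \<open>B\<close> are
  \<open>F'\<close>-independent, each of the \<open>L\<close> pairs of such an \<open>h\<close> and one of the two sets accounts for at
  most one point, which is a contradiction.
\<close>

section \<open>Clopen subsets of the free part\<close>

lemma shift_in_Free:
  assumes "x \<in> Free"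
  shows "shift f x \<in> Free"
  unfolding Free_def
proof (intro CollectI allI impI)
  fix g
  assume "shift g (shift f x) = shift f x"
  then have "shift (g + f) x = shift f x"
    by (simp add: shift_shift)
  then show "g = 0"
    using shift_eq_iff [OF assms] by simp
qed

lemma continuous_on_shift: "continuous_on A (shift f)"
  unfolding shift_def
  by (intro continuous_on_coordinatewise_then_product
      continuous_on_subset [OF continuous_on_product_coordinates] subset_UNIV)

lemma openin_Free_vimage_shift:
  assumes "openin (top_of_set Free) M"
  shows "openin (top_of_set Free) {x \<in> Free. shift f x \<in> M}"
proof -
  have "openin (top_of_set Free) (Free \<inter> shift f -` M)"
    by (rule continuous_openin_preimage [OF continuous_on_shift _ assms]) (auto intro: shift_in_Free)
  then show ?thesis
    by (simp add: vimage_def Int_def)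
qed

lemma clopen_in_Free_subset: "clopen_in_Free M \<Longrightarrow> M \<subseteq> Free"
  by (auto simp: clopen_in_Free_def dest: openin_imp_subset)

lemma clopen_in_Free_iff:
  "clopen_in_Free M \<longleftrightarrow> openin (top_of_set Free) M \<and> openin (top_of_set Free) (Free - M)"
  by (auto simp: clopen_in_Free_def closedin_def dest: openin_imp_subset)

lemma clopen_in_Free_empty: "clopen_in_Free {}"
  by (simp add: clopen_in_Free_def)

lemma clopen_in_Free_Free: "clopen_in_Free Free"
  by (simp add: clopen_in_Free_def)

lemma clopen_in_Free_Un: "clopen_in_Free A \<Longrightarrow> clopen_in_Free B \<Longrightarrow> clopen_in_Free (A \<union> B)"
  by (auto simp: clopen_in_Free_def)

lemma clopen_in_Free_Int: "clopen_in_Free A \<Longrightarrow> clopen_in_Free B \<Longrightarrow> clopen_in_Free (A \<inter> B)"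
  by (auto simp: clopen_in_Free_def)

lemma clopen_in_Free_Compl: "clopen_in_Free A \<Longrightarrow> clopen_in_Free (Free - A)"
  by (auto simp: clopen_in_Free_def)

lemma clopen_in_Free_vimage_shift:
  assumes "clopen_in_Free M"
  shows "clopen_in_Free {x \<in> Free. shift f x \<in> M}"
proof -
  have "Free - {x \<in> Free. shift f x \<in> M} = {x \<in> Free. shift f x \<in> Free - M}"
    by (auto intro: shift_in_Free)
  then show ?thesis
    using assms by (simp add: clopen_in_Free_iff openin_Free_vimage_shift del: Diff_iff)
qed

lemma clopen_in_Free_ball:
  assumes "finite F" and "\<And>f. f \<in> F \<Longrightarrow> clopen_in_Free {x \<in> Free. P f x}"
  shows "clopen_in_Free {x \<in> Free. \<forall>f\<in>F. P f x}"
  using assms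
proof (induction F)
  case empty
  then show ?case
    by (simp add: clopen_in_Free_Free)
next
  case (insert f F)
  have "{x \<in> Free. \<forall>f\<in>insert f F. P f x} = {x \<in> Free. P f x} \<inter> {x \<in> Free. \<forall>f\<in>F. P f x}"
    by auto
  then show ?case
    using insert by (auto intro: clopen_in_Free_Int)
qed

text \<open>This keeps every stage of the greedy selection below clopen; finiteness of
  \<open>F\<close> makes the intersection involved finite.\<close>

lemma clopen_in_Free_avoiding_shifts:
  assumes "finite F" and "clopen_in_Free M"
  shows "clopen_in_Free {x \<in> Free. \<forall>f\<in>F. shift f x \<notin> M}"
proof (rule clopen_in_Free_ball [OF assms(1)])
  fix f
  have "{x \<in> Free. shift f x \<notin> M} = Free - {x \<in> Free. shift f x \<in> M}"
    by auto
  then show "clopen_in_Free {x \<in> Free. shift f x \<notin> M}"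
    using clopen_in_Free_Compl [OF clopen_in_Free_vimage_shift [OF assms(2)]] by simp
qed

lemma clopen_in_Free_coordinate:
  fixes a :: "int ^ 'n"
  shows "clopen_in_Free {x \<in> Free. x a = v}"
proof -
  have cont: "continuous_on Free (\<lambda>x :: int ^ 'n \<Rightarrow> bool. x a)"
    by (rule continuous_on_subset [OF continuous_on_product_coordinates]) simp
  have "openin (top_of_set Free) (Free \<inter> (\<lambda>x :: int ^ 'n \<Rightarrow> bool. x a) -` U)" for U
    by (rule continuous_openin_preimage [OF cont, of UNIV]) (auto simp: open_discrete)
  from this [of "{v}"] this [of "- {v}"] show ?thesis
    by (simp add: clopen_in_Free_iff vimage_def Int_def set_diff_eq cong: conj_cong)
qed

section \<open>Maximal independent sets\<close>

definition independent_under :: "(int ^ 'n) set \<Rightarrow> (int ^ 'n \<Rightarrow> bool) set \<Rightarrow> bool"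
  where "independent_under F M \<longleftrightarrow> (\<forall>x\<in>M. \<forall>f\<in>F. shift f x \<notin> M)"

lemma independent_underD: "independent_under F M \<Longrightarrow> x \<in> M \<Longrightarrow> f \<in> F \<Longrightarrow> shift f x \<notin> M"
  by (simp add: independent_under_def)

lemma independent_under_mono: "independent_under F' M \<Longrightarrow> F \<subseteq> F' \<Longrightarrow> independent_under F M"
  by (auto simp: independent_under_def)

text \<open>It suffices to exclude conflicts from \<open>B\<close> to \<open>A\<close>: a conflict
  from \<open>A\<close> to \<open>B\<close> by \<open>f\<close>, read backwards, is one from
  \<open>B\<close> to \<open>A\<close> by \<open>- f\<close>.\<close>

lemma independent_under_Un:
  assumes "independent_under F A" and "independent_under F B"
    and "\<And>f. f \<in> F \<Longrightarrow> - f \<in> F"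
    and "\<And>x f. x \<in> B \<Longrightarrow> f \<in> F \<Longrightarrow> shift f x \<notin> A"
  shows "independent_under F (A \<union> B)"
proof -
  have "shift f x \<notin> B" if "x \<in> A" "f \<in> F" for x f
    using assms(4) [of "shift f x" "- f"] assms(3) that by (auto simp: shift_shift)
  then show ?thesis
    using assms(1,2,4) by (auto simp: independent_under_def)
qed

lemma countable_UNIV_int_vec: "countable (UNIV :: (int ^ 'n) set)"
proof -
  have "(UNIV :: (int ^ 'n) set) = range vec_lambda"
    by (metis vec_lambda_eta surjI)
  then show ?thesis
    by simp
qed

text \<open>A free point differs from its translate by each \<open>f\<close> in \<open>F\<close> at
  some coordinate. One such coordinate for every \<open>f\<close>, with the value there, gives a
  clopen condition, and as \<open>F\<close> is finite there are only countably many such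
  data.\<close>

lemma countable_clopen_independent_cover:
  fixes F :: "(int ^ 'n) set"
  assumes "finite F" and "0 \<notin> F"
  obtains U :: "nat \<Rightarrow> (int ^ 'n \<Rightarrow> bool) set"
  where "\<And>i. clopen_in_Free (U i)" and "\<And>i. independent_under F (U i)"
    and "Free \<subseteq> (\<Union>i. U i)"
proof
  \<comment> \<open>Functions extensional on the finite set \<open>F\<close>, as all functions on
    \<open>int ^ 'n\<close> would form an uncountable family.\<close>
  define P where "P = F \<rightarrow>\<^sub>E (UNIV :: ((int ^ 'n) \<times> bool) set)"
  \<comment> \<open>Asking only for \<open>x (f + h) \<noteq> x h\<close> would not keep \<open>shift f x\<close> out of the set; recording the value
    \<open>x h\<close> as well does.\<close>
  define U where "U p = {x \<in> Free. \<forall>f\<in>F. x (fst (p f)) = snd (p f) \<and> x (f + fst (p f)) = (\<not> snd (p f))}"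
    for p :: "int ^ 'n \<Rightarrow> (int ^ 'n) \<times> bool"
  have "countable (UNIV :: ((int ^ 'n) \<times> bool) set)"
    unfolding UNIV_Times_UNIV [symmetric] by (intro countable_SIGMA countable_UNIV_int_vec) simp
  then have "countable P" and "P \<noteq> {}"
    using assms(1) by (auto simp: P_def PiE_eq_empty_iff intro!: countable_PiE)
  then have range: "range (from_nat_into P) = P"
    by (simp add: range_from_nat_into)
  have "clopen_in_Free {x \<in> Free. x a = u \<and> x b = v}" for a b :: "int ^ 'n" and u v
  proof -
    have "{x \<in> Free. x a = u \<and> x b = v} = {x \<in> Free. x a = u} \<inter> {x \<in> Free. x b = v}"
      by auto
    then show ?thesis
      by (simp only: clopen_in_Free_Int clopen_in_Free_coordinate)
  qed
  then show "clopen_in_Free (U (from_nat_into P i))" for i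
    unfolding U_def by (intro clopen_in_Free_ball assms)
  show "independent_under F (U (from_nat_into P i))" for i
    by (auto simp: independent_under_def U_def shift_def)
  show "Free \<subseteq> (\<Union>i. U (from_nat_into P i))"
  proof
    fix x :: "int ^ 'n \<Rightarrow> bool"
    assume "x \<in> Free"
    then have "\<exists>h. x (f + h) \<noteq> x h" if "f \<in> F" for f
      using assms(2) that by (auto simp: Free_def shift_def fun_eq_iff)
    then obtain h where h: "\<forall>f\<in>F. x (f + h f) \<noteq> x (h f)"
      by metis
    define p where "p = restrict (\<lambda>f. (h f, x (h f))) F"
    have "x \<in> U p"
      using \<open>x \<in> Free\<close> h by (simp add: U_def p_def)
    moreover have "p \<in> P"
      by (simp add: P_def p_def)
    ultimately show "x \<in> (\<Union>i. U (from_nat_into P i))"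
      using range by (metis UN_I UNIV_I imageE)
  qed
qed

text \<open>Go through the countable cover and greedily add those points of \<open>V\<close> in the
  next piece that have no translate by \<open>F\<close> among the earlier choices. The union is
  open; maximality makes it closed as well.\<close>

lemma maximal_clopen_independent:
  fixes F :: "(int ^ 'n) set"
  assumes "finite F" and "0 \<notin> F" and uminus: "\<And>f. f \<in> F \<Longrightarrow> - f \<in> F"
    and V: "clopen_in_Free V"
  obtains M where "clopen_in_Free M" and "M \<subseteq> V" and "independent_under F M"
    and "\<And>x. x \<in> V \<Longrightarrow> x \<notin> M \<Longrightarrow> \<exists>f\<in>F. shift f x \<in> M"
proof -
  obtain U :: "nat \<Rightarrow> (int ^ 'n \<Rightarrow> bool) set"
    where U: "\<And>i. clopen_in_Free (U i)" "\<And>i. independent_under F (U i)"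
      and cover: "Free \<subseteq> (\<Union>i. U i)"
    using countable_clopen_independent_cover [OF assms(1,2)] by blast
  define N where "N = rec_nat {} (\<lambda>i A. A \<union> (V \<inter> U i \<inter> {x \<in> Free. \<forall>f\<in>F. shift f x \<notin> A}))"
  have N_0: "N 0 = {}"
    and N_Suc: "N (Suc i) = N i \<union> (V \<inter> U i \<inter> {x \<in> Free. \<forall>f\<in>F. shift f x \<notin> N i})" for i
    by (simp_all add: N_def)
  have N_clopen: "clopen_in_Free (N i)" for i
    by (induction i) (simp_all add: N_0 N_Suc clopen_in_Free_empty clopen_in_Free_Un
        clopen_in_Free_Int clopen_in_Free_avoiding_shifts V U(1) assms(1))
  have N_indep: "independent_under F (N i)" for i
  proof (induction i)
    case 0
    then show ?case
      by (simp add: N_0 independent_under_def)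
  next
    case (Suc i)
    \<comment> \<open>Two points added at the same stage both lie in \<open>U i\<close>, hence do
      not conflict.\<close>
    show ?case
      unfolding N_Suc using U(2) [of i]
      by (intro independent_under_Un Suc uminus) (auto simp: independent_under_def)
  qed
  have N_sub: "N i \<subseteq> V" for i
    by (induction i) (auto simp: N_0 N_Suc)
  have "mono N"
    by (intro mono_iff_le_Suc [THEN iffD2] allI) (auto simp: N_Suc)
  define M where "M = (\<Union>i. N i)"
  have M_sub: "M \<subseteq> V"
    using N_sub by (auto simp: M_def)
  have M_indep: "independent_under F M"
    unfolding independent_under_def
  proof (intro ballI notI)
    fix x f
    assume "x \<in> M" "f \<in> F" "shift f x \<in> M"
    then obtain i j where "x \<in> N i" "shift f x \<in> N j"
      by (auto simp: M_def)
    then have "x \<in> N (max i j)" "shift f x \<in> N (max i j)"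
      using monoD [OF \<open>mono N\<close>, of i "max i j"] monoD [OF \<open>mono N\<close>, of j "max i j"] by auto
    then show False
      using independent_underD [OF N_indep] \<open>f \<in> F\<close> by blast
  qed
  have maximal: "\<exists>f\<in>F. shift f x \<in> M" if "x \<in> V" "x \<notin> M" for x
  proof -
    have "x \<in> Free"
      using clopen_in_Free_subset [OF V] that by auto
    then obtain i where "x \<in> U i"
      using cover by auto
    \<comment> \<open>Were no translate of \<open>x\<close> by \<open>F\<close> in
      \<open>N i\<close>, this stage would have added \<open>x\<close>.\<close>
    moreover have "x \<notin> N (Suc i)"
      using that by (auto simp: M_def)
    ultimately show ?thesis
      using \<open>x \<in> Free\<close> that by (auto simp: N_Suc M_def)
  qed
  have M_open: "openin (top_of_set Free) M"
    unfolding M_def using N_clopen by (intro openin_Union) (auto simp: clopen_in_Free_def)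
  \<comment> \<open>By maximality every point of \<open>V\<close> outside \<open>M\<close> has a
    translate in \<open>M\<close>; by independence no point of \<open>M\<close> has one.\<close>
  have "Free - M = (Free - V) \<union> (\<Union>f\<in>F. {x \<in> Free. shift f x \<in> M})"
    using M_sub maximal independent_underD [OF M_indep] by blast
  also have "openin (top_of_set Free) \<dots>"
    using V by (intro openin_Un openin_Union) (auto simp: clopen_in_Free_iff openin_Free_vimage_shift M_open)
  finally have "clopen_in_Free M"
    using M_open by (simp add: clopen_in_Free_iff)
  then show thesis
    using that M_sub M_indep maximal by blast
qed

section \<open>Serving one direction after another\<close>

lemma int_smult_simps:
  fixes g :: "int ^ 'n"
  shows "a *s g + b *s g = (a + b) *s g" and "- (a *s g) = (- a) *s g"
  by (simp_all add: vec_eq_iff distrib_right)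

lemma serve_direction:
  fixes g :: "int ^ 'n"
  assumes "finite F" and uminus: "\<And>f. f \<in> F \<Longrightarrow> - f \<in> F"
    and L: "L = 2 * card (insert 0 F)"
    and F': "F' = F \<union> (\<lambda>j. j *s g) ` ({- int L..int L} - {0})"
    and A: "independent_under F' A" and B: "independent_under F' B"
    and maximal: "\<And>y. y \<in> Free \<Longrightarrow> \<forall>h\<in>insert 0 F. shift h y \<notin> A \<Longrightarrow> y \<notin> B \<Longrightarrow> \<exists>f\<in>F'. shift f y \<in> B"
    and "x \<in> Free"
  shows "\<exists>a \<le> 3 * L. shift (int a *s g) x \<in> B"
proof (rule ccontr)
  assume contra: "\<not> ?thesis"
  have missed: "shift (t *s g) x \<notin> B" if "0 \<le> t" "t \<le> 3 * int L" for t
    using contra that by (auto dest!: spec [of _ "nat t"])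
  \<comment> \<open>With \<open>True\<close> for \<open>A\<close> and \<open>False\<close> for
    \<open>B\<close>, the pigeonholes are the \<open>L\<close> pairs in
    \<open>UNIV \<times> insert 0 F\<close>.\<close>
  define C where "C = case_bool A B"
  have "\<exists>c. snd c \<in> insert 0 F \<and> shift (snd c + t *s g) x \<in> C (fst c)"
    if t: "t \<in> {int L..2 * int L}" for t
  proof (cases "\<exists>h\<in>insert 0 F. shift h (shift (t *s g) x) \<in> A")
    case True
    then obtain h where "h \<in> insert 0 F" "shift (h + t *s g) x \<in> A"
      unfolding shift_shift by blast
    then show ?thesis
      by (intro exI [of _ "(True, h)"]) (simp add: C_def)
  next
    case False
    then obtain f where f: "f \<in> F'" "shift (f + t *s g) x \<in> B"
      using maximal [of "shift (t *s g) x"] missed [of t] t \<open>x \<in> Free\<close>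
      by (auto simp: shift_in_Free shift_shift)
    \<comment> \<open>Otherwise \<open>f\<close> is \<open>j *s g\<close> with \<open>j\<close>
      between \<open>- L\<close> and \<open>L\<close>. As \<open>t\<close> is in the middle third,
      \<open>j + t\<close> lies between \<open>0\<close> and \<open>3 * L\<close>, where
      \<open>B\<close> is missed.\<close>
    have "f \<in> F"
    proof (rule ccontr)
      assume "f \<notin> F"
      then obtain j where "f = j *s g" "j \<in> {- int L..int L}"
        using f(1) unfolding F' by blast
      then have "shift ((j + t) *s g) x \<in> B"
        using f(2) by (metis int_smult_simps(1))
      then show False
        using missed [of "j + t"] t \<open>j \<in> {- int L..int L}\<close> by auto
    qed
    then show ?thesis
      using f(2) by (intro exI [of _ "(False, f)"]) (simp add: C_def)
  qed
  then obtain c where c: "\<And>t. t \<in> {int L..2 * int L} \<Longrightarrow>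
      snd (c t) \<in> insert 0 F \<and> shift (snd (c t) + t *s g) x \<in> C (fst (c t))"
    by metis
  have neq: "c s \<noteq> c t" if "s \<in> {int L..2 * int L}" "t \<in> {int L..2 * int L}" "s < t" for s t
  proof
    assume eq: "c s = c t"
    \<comment> \<open>\<open>z\<close> and its translate by \<open>(t - s) *s g\<close> would lie in
      the same set, although \<open>0 < t - s \<le> L\<close> puts this displacement in
      \<open>F'\<close>.\<close>
    define z where "z = shift (snd (c s) + s *s g) x"
    have "t - s \<in> {- int L..int L} - {0}"
      using that by auto
    then have diff: "(t - s) *s g \<in> F'"
      unfolding F' by (intro UnI2 imageI)
    have "shift ((t - s) *s g) z = shift (snd (c t) + t *s g) x"
      by (simp add: z_def shift_shift eq vec_eq_iff algebra_simps)
    then have "shift ((t - s) *s g) z \<in> C (fst (c s))"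
      using c [OF that(2)] by (simp add: eq)
    moreover have "z \<in> C (fst (c s))"
      using c [OF that(1)] by (simp add: z_def)
    moreover have "independent_under F' (C (fst (c s)))"
      using A B by (cases "fst (c s)") (simp_all add: C_def)
    ultimately show False
      using independent_underD diff by blast
  qed
  have "inj_on c {int L..2 * int L}"
    by (intro linorder_inj_onI') (use neq in blast)
  moreover have "c ` {int L..2 * int L} \<subseteq> UNIV \<times> insert 0 F"
    using c by (intro image_subsetI) (simp only: mem_Times_iff UNIV_I simp_thms)
  ultimately have "card {int L..2 * int L} \<le> card ((UNIV :: bool set) \<times> insert 0 F)"
    using assms(1) by (intro card_inj_on_le [of c]) auto
  then show False
    unfolding L by (simp add: card_cartesian_product)
qed

text \<open>The induction varies \<open>F\<close>: the earlier directions are served by a set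
  independent under the larger \<open>F'\<close>, and since \<open>B\<close> avoids only the
  \<open>F\<close>-conflicts with \<open>A\<close>, the union is guaranteed to be independent just
  under \<open>F\<close>. Forward multiples suffice here; backward ones are deduced from them at the
  end.\<close>

lemma clopen_independent_hitting:
  fixes S :: "(int ^ 'n) set"
  assumes "finite S" and "0 \<notin> S"
    and "finite F" and "0 \<notin> F" and "\<And>f. f \<in> F \<Longrightarrow> - f \<in> F"
  shows "\<exists>\<Delta> M. clopen_in_Free M \<and> independent_under F M \<and>
    (\<forall>g\<in>S. \<forall>x\<in>Free. \<exists>a\<le>\<Delta>. shift (int a *s g) x \<in> M)"
  using assms
proof (induction S arbitrary: F)
  case empty
  then show ?case
    by (intro exI [of _ 0] exI [of _ "{}"]) (simp add: clopen_in_Free_empty independent_under_def)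
next
  case (insert g S)
  define L where "L = 2 * card (insert 0 F)"
  define F' where "F' = F \<union> (\<lambda>j. j *s g) ` ({- int L..int L} - {0})"
  have F_F': "F \<subseteq> F'"
    by (simp add: F'_def)
  have "finite F'"
    using insert.prems by (simp add: F'_def)
  \<comment> \<open>The group is torsion-free and \<open>g\<close> is nonzero, so
    \<open>j *s g\<close> vanishes only for \<open>j = 0\<close>.\<close>
  have "0 \<notin> F'"
    using insert.prems by (auto simp: F'_def vec_eq_iff)
  have uminus': "- f \<in> F'" if "f \<in> F'" for f
    using that unfolding F'_def
  proof (elim UnE imageE)
    fix j
    assume "f = j *s g" "j \<in> {- int L..int L} - {0}"
    then show "- f \<in> F \<union> (\<lambda>j. j *s g) ` ({- int L..int L} - {0})"
      by (intro UnI2 image_eqI [of _ _ "- j"]) (auto simp: int_smult_simps)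
  qed (simp add: insert.prems)
  obtain \<Delta> A where A: "clopen_in_Free A" "independent_under F' A"
    and hits: "\<forall>h\<in>S. \<forall>x\<in>Free. \<exists>a\<le>\<Delta>. shift (int a *s h) x \<in> A"
    using insert.IH [OF _ \<open>finite F'\<close> \<open>0 \<notin> F'\<close> uminus'] insert.prems by auto
  define V where "V = {x \<in> Free. \<forall>h\<in>insert 0 F. shift h x \<notin> A}"
  have "clopen_in_Free V"
    unfolding V_def using A insert.prems by (intro clopen_in_Free_avoiding_shifts) auto
  then obtain B where B: "clopen_in_Free B" "B \<subseteq> V" "independent_under F' B"
    and maximal: "\<And>x. x \<in> V \<Longrightarrow> x \<notin> B \<Longrightarrow> \<exists>f\<in>F'. shift f x \<in> B"
    using maximal_clopen_independent [OF \<open>finite F'\<close> \<open>0 \<notin> F'\<close> uminus'] by metis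
  have "\<exists>a \<le> 3 * L. shift (int a *s g) x \<in> B" if "x \<in> Free" for x
    using maximal
    by (intro serve_direction [OF _ _ L_def F'_def A(2) B(3)] insert.prems that) (auto simp: V_def)
  with hits have "\<forall>h\<in>insert g S. \<forall>x\<in>Free. \<exists>a \<le> max \<Delta> (3 * L). shift (int a *s h) x \<in> A \<union> B"
    by (metis UnCI insert_iff max.coboundedI1 max.coboundedI2)
  moreover have "clopen_in_Free (A \<union> B)"
    using A B by (intro clopen_in_Free_Un)
  moreover have "independent_under F (A \<union> B)"
    using B(2) insert.prems
    by (intro independent_under_Un independent_under_mono [OF A(2) F_F']
        independent_under_mono [OF B(3) F_F']) (auto simp: V_def)
  ultimately show ?case
    by blast
qed

section \<open>Balls of the sup norm, and the marker theorem\<close>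

lemma sup_norm_less_iff: "sup_norm h < k \<longleftrightarrow> (\<forall>i. \<bar>h $ i\<bar> < k)"
  by (simp add: sup_norm_def)

lemma finite_sup_norm_less: "finite {h :: int ^ 'n. sup_norm h < k}"
proof -
  have "{h :: int ^ 'n. sup_norm h < k} \<subseteq> vec_lambda ` (UNIV \<rightarrow>\<^sub>E {- k..k})"
  proof
    fix h :: "int ^ 'n"
    assume "h \<in> {h. sup_norm h < k}"
    then have "\<forall>i. \<bar>h $ i\<bar> < k"
      by (simp add: sup_norm_less_iff)
    then have "h $ i \<in> {- k..k}" for i
      by (auto simp: abs_less_iff dest!: spec [of _ i])
    then show "h \<in> vec_lambda ` (UNIV \<rightarrow>\<^sub>E {- k..k})"
      by (intro image_eqI [of _ _ "vec_nth h"]) auto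
  qed
  then show ?thesis
    by (rule finite_subset) (intro finite_imageI finite_PiE, auto)
qed

theorem theorem1p2:
  fixes d :: nat and S :: "(int ^ 'n) set"
  assumes "d > 0"
    and "finite S"
    and "0 \<notin> S"
    and "group_closure S = UNIV"
  shows "\<exists>(\<Delta>::nat) (M :: (int ^ 'n \<Rightarrow> bool) set).
    \<Delta> > 0 \<and> \<Delta> \<ge> d \<and> clopen_in_Free M \<and>
    (\<forall>x\<in>M. \<forall>y\<in>M. x \<noteq> y \<and> y \<in> orbit x \<longrightarrow> rho x y \<ge> int d) \<and>
    (\<forall>g\<in>S. \<forall>x\<in>Free. \<exists>a b :: nat. a \<le> \<Delta> \<and> b \<le> \<Delta> \<and>
       shift (int a *s g) x \<in> M \<and> shift (- int b *s g) x \<in> M)"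
proof -
  \<comment> \<open>Independence under this finite symmetric set is the distance condition on
    \<open>M\<close>.\<close>
  define F where "F = {h :: int ^ 'n. sup_norm h < int d} - {0}"
  have "finite F" and "0 \<notin> F" and "\<And>f. f \<in> F \<Longrightarrow> - f \<in> F"
    by (auto simp: F_def finite_sup_norm_less) (simp add: sup_norm_less_iff)
  then obtain \<Delta> M where M: "clopen_in_Free M" "independent_under F M"
    and hits: "\<And>g x. g \<in> S \<Longrightarrow> x \<in> Free \<Longrightarrow> \<exists>a\<le>\<Delta>. shift (int a *s g) x \<in> M"
    using clopen_independent_hitting [OF assms(2,3)] by metis
  have "rho x y \<ge> int d" if "x \<in> M" "y \<in> M" "x \<noteq> y" "y \<in> orbit x" for x y
  proof -
    obtain g where g: "y = shift g x"
      using \<open>y \<in> orbit x\<close> by (auto simp: orbit_def)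
    then have "g \<notin> F" and "g \<noteq> 0"
      using that independent_underD [OF M(2), of x g] by auto
    moreover have "x \<in> Free"
      using M(1) clopen_in_Free_subset \<open>x \<in> M\<close> by blast
    ultimately show ?thesis
      by (simp add: g rho_shift F_def)
  qed
  moreover have "\<exists>a b. a \<le> max \<Delta> d \<and> b \<le> max \<Delta> d \<and>
      shift (int a *s g) x \<in> M \<and> shift (- int b *s g) x \<in> M"
    if "g \<in> S" "x \<in> Free" for g x
  proof -
    obtain a where "a \<le> \<Delta>" "shift (int a *s g) x \<in> M"
      using hits [OF \<open>g \<in> S\<close> \<open>x \<in> Free\<close>] by blast
    \<comment> \<open>Start \<open>\<Delta>\<close> steps behind \<open>x\<close>: a hit after
      \<open>c\<close> forward steps lies \<open>\<Delta> - c\<close> steps behind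
      \<open>x\<close>.\<close>
    moreover obtain c where "c \<le> \<Delta>" "shift (int c *s g) (shift (- int \<Delta> *s g) x) \<in> M"
      using hits [OF \<open>g \<in> S\<close> shift_in_Free [OF \<open>x \<in> Free\<close>]] by blast
    moreover from this have "shift (- int (\<Delta> - c) *s g) x \<in> M"
      by (simp add: shift_shift int_smult_simps of_nat_diff)
    ultimately show ?thesis
      by (meson diff_le_self le_trans max.cobounded1)
  qed
  ultimately show ?thesis
    using M(1) \<open>d > 0\<close> by (intro exI [of _ "max \<Delta> d"] exI [of _ M]) auto
qed

end
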